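(* Let $X$ be a compact Hausdorff space and let $\tau$ be a state operator on $C_1(X)$. Then $\tau$ is a conditional expectation if and only if $\tau$ is strong.
   Context: $C_1(X)$ is the set of continuous functions $f:X\to[0,1]$, an effect algebra with $f\oplus g=f+g$ defined iff $f+g\le1$; it is a lattice under the pointwise order, with pointwise minimum and maximum. A state operator on $C_1(X)$ is a map $\tau:C_1(X)\to C_1(X)$ with $\tau(1)=1$, $\tau(f+g)=\tau(f)+\tau(g)$ whenever $f+g\le1$, and $\tau\circ\tau=\tau$. It is strong if $\tau(\tau(f)\wedge\tau(g))=\tau(f)\wedge\tau(g)$ for all $f,g\in C_1(X)$. A conditional expectation on $C_1(X)$ is a map $\tau:C_1(X)\to C_1(X)$ with $\tau(1)=1$, $\tau(f+g)=\tau(f)+\tau(g)$ whenever $f+g\le1$, and $\tau(\tau(f)\,g\,\tau(f))=\tau(f)\,\tau(g)\,\tau(f)$ for all $f,g\in C_1(X)$ (pointwise products). *)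

theory Defs
  imports "HOL-Analysis.Analysis"
begin

text \<open>
  A function on the space \<open>X\<close> is represented by its \<^const>\<open>extensional\<close> extension to the
  whole type, so that equality in \<open>C1 X\<close> is equality on the points of \<open>X\<close>; the
  pointwise operations are restricted to \<open>topspace X\<close> accordingly.
\<close>

definition C1 :: "'a topology \<Rightarrow> ('a \<Rightarrow> real) set" where
  "C1 X = {f \<in> extensional (topspace X). continuous_map X (top_of_set {0..1}) f}"

definition C1_one :: "'a topology \<Rightarrow> 'a \<Rightarrow> real" where
  "C1_one X = (\<lambda>x\<in>topspace X. 1)"

text \<open>\<open>C1_summable X f g\<close> is the domain of the partial addition of the effect algebra;
  \<open>C1_add X f g\<close> is only meaningful there.\<close>

definition C1_summable :: "'a topology \<Rightarrow> ('a \<Rightarrow> real) \<Rightarrow> ('a \<Rightarrow> real) \<Rightarrow> bool" where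
  "C1_summable X f g \<longleftrightarrow> (\<forall>x\<in>topspace X. f x + g x \<le> 1)"

definition C1_add :: "'a topology \<Rightarrow> ('a \<Rightarrow> real) \<Rightarrow> ('a \<Rightarrow> real) \<Rightarrow> 'a \<Rightarrow> real" where
  "C1_add X f g = (\<lambda>x\<in>topspace X. f x + g x)"

definition C1_mult :: "'a topology \<Rightarrow> ('a \<Rightarrow> real) \<Rightarrow> ('a \<Rightarrow> real) \<Rightarrow> 'a \<Rightarrow> real" where
  "C1_mult X f g = (\<lambda>x\<in>topspace X. f x * g x)"

definition C1_inf :: "'a topology \<Rightarrow> ('a \<Rightarrow> real) \<Rightarrow> ('a \<Rightarrow> real) \<Rightarrow> 'a \<Rightarrow> real" where
  "C1_inf X f g = (\<lambda>x\<in>topspace X. min (f x) (g x))"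

definition unital_additive :: "'a topology \<Rightarrow> (('a \<Rightarrow> real) \<Rightarrow> 'a \<Rightarrow> real) \<Rightarrow> bool" where
  "unital_additive X \<tau> \<longleftrightarrow>
     \<tau> \<in> C1 X \<rightarrow> C1 X \<and>
     \<tau> (C1_one X) = C1_one X \<and>
     (\<forall>f\<in>C1 X. \<forall>g\<in>C1 X. C1_summable X f g \<longrightarrow> \<tau> (C1_add X f g) = C1_add X (\<tau> f) (\<tau> g))"

definition state_operator :: "'a topology \<Rightarrow> (('a \<Rightarrow> real) \<Rightarrow> 'a \<Rightarrow> real) \<Rightarrow> bool" where
  "state_operator X \<tau> \<longleftrightarrow>
     unital_additive X \<tau> \<and> (\<forall>f\<in>C1 X. \<tau> (\<tau> f) = \<tau> f)"

definition strong_state_operator :: "'a topology \<Rightarrow> (('a \<Rightarrow> real) \<Rightarrow> 'a \<Rightarrow> real) \<Rightarrow> bool" where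
  "strong_state_operator X \<tau> \<longleftrightarrow>
     state_operator X \<tau> \<and>
     (\<forall>f\<in>C1 X. \<forall>g\<in>C1 X. \<tau> (C1_inf X (\<tau> f) (\<tau> g)) = C1_inf X (\<tau> f) (\<tau> g))"

definition conditional_expectation :: "'a topology \<Rightarrow> (('a \<Rightarrow> real) \<Rightarrow> 'a \<Rightarrow> real) \<Rightarrow> bool" where
  "conditional_expectation X \<tau> \<longleftrightarrow>
     unital_additive X \<tau> \<and>
     (\<forall>f\<in>C1 X. \<forall>g\<in>C1 X.
        \<tau> (C1_mult X (C1_mult X (\<tau> f) g) (\<tau> f)) = C1_mult X (C1_mult X (\<tau> f) (\<tau> g)) (\<tau> f))"

end

theory Submission
  imports Defs
begin

text \<open>
  For a point \<open>x\<close> of \<open>X\<close>, \<open>f \<mapsto> \<tau> f x\<close> is a state \<open>\<phi>\<close> on \<open>C\<^sub>1(X)\<close>: positive, additive and, by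
  the Archimedean property, homogeneous. For a state operator, both properties are equivalent to
  \<open>\<phi>(\<bar>a - a(x)\<bar>) = 0\<close> for all \<open>x\<close> and all \<open>a\<close> in the range of \<open>\<tau>\<close>, i.e. \<open>\<phi>\<close> does not
  distinguish \<open>a\<close> from the constant \<open>a(x)\<close>.
  If \<open>\<tau>\<close> is strong, this follows from \<open>\<bar>a - c\<bar> = a + c - 2 (a \<and> c)\<close>. If \<open>\<tau>\<close> is a conditional
  expectation, then \<open>\<tau>(a\<^sup>2) = a\<^sup>2\<close> gives \<open>\<phi>((a - a(x))\<^sup>2) = 0\<close>, and the Cauchy--Schwarz argument
  applies. Conversely, \<open>a\<^sup>2 g\<close> and \<open>a \<and> b\<close> are Lipschitz in \<open>a\<close> and \<open>b\<close>, so under \<open>\<phi>\<close> the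
  functions \<open>a, b\<close> in them can be replaced by their values at \<open>x\<close>.
\<close>

section \<open>Membership and closure rules for \<open>C1 X\<close>\<close>

lemma C1_iff:
  "f \<in> C1 X \<longleftrightarrow> f \<in> extensional (topspace X) \<and> continuous_map X euclideanreal f \<and>
     (\<forall>x\<in>topspace X. 0 \<le> f x \<and> f x \<le> 1)"
  unfolding C1_def by (auto simp: continuous_map_in_subtopology Pi_iff)

lemma C1_nonneg: "f \<in> C1 X \<Longrightarrow> x \<in> topspace X \<Longrightarrow> 0 \<le> f x"
  and C1_le_1: "f \<in> C1 X \<Longrightarrow> x \<in> topspace X \<Longrightarrow> f x \<le> 1"
  and C1_extensional: "f \<in> C1 X \<Longrightarrow> f \<in> extensional (topspace X)"
  by (auto simp: C1_iff)

lemma C1_restrictI: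
  assumes "continuous_map X euclideanreal f"
    and "\<And>x. x \<in> topspace X \<Longrightarrow> 0 \<le> f x" and "\<And>x. x \<in> topspace X \<Longrightarrow> f x \<le> 1"
  shows "restrict f (topspace X) \<in> C1 X"
proof -
  have "continuous_map X euclideanreal (restrict f (topspace X))"
    using assms(1) by (rule continuous_map_eq) simp
  then show ?thesis using assms by (auto simp: C1_iff)
qed

lemma C1_const: "0 \<le> c \<Longrightarrow> c \<le> 1 \<Longrightarrow> (\<lambda>x\<in>topspace X. c) \<in> C1 X"
  by (rule C1_restrictI) auto

lemma C1_scale: "f \<in> C1 X \<Longrightarrow> 0 \<le> r \<Longrightarrow> r \<le> 1 \<Longrightarrow> (\<lambda>x\<in>topspace X. r * f x) \<in> C1 X"
  by (rule C1_restrictI)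
    (auto intro!: continuous_map_real_mult_left mult_le_one simp: C1_iff)

lemma C1_add_closed: "f \<in> C1 X \<Longrightarrow> g \<in> C1 X \<Longrightarrow> C1_summable X f g \<Longrightarrow> C1_add X f g \<in> C1 X"
  unfolding C1_add_def C1_summable_def
  by (rule C1_restrictI) (auto intro!: continuous_intros simp: C1_iff)

lemma C1_mult_closed: "f \<in> C1 X \<Longrightarrow> g \<in> C1 X \<Longrightarrow> C1_mult X f g \<in> C1 X"
  unfolding C1_mult_def
  by (rule C1_restrictI) (auto intro!: continuous_intros mult_le_one simp: C1_iff)

lemma C1_inf_closed: "f \<in> C1 X \<Longrightarrow> g \<in> C1 X \<Longrightarrow> C1_inf X f g \<in> C1 X"
  unfolding C1_inf_def
  by (rule C1_restrictI) (auto intro!: continuous_intros simp: C1_iff min_le_iff_disj)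

lemma C1_dist_const:
  assumes "f \<in> C1 X" and "0 \<le> c" and "c \<le> 1"
  shows "(\<lambda>x\<in>topspace X. \<bar>f x - c\<bar>) \<in> C1 X"
proof (rule C1_restrictI)
  show "continuous_map X euclideanreal (\<lambda>x. \<bar>f x - c\<bar>)"
    using assms by (auto intro!: continuous_intros simp: C1_iff)
next
  fix x assume "x \<in> topspace X"
  then show "\<bar>f x - c\<bar> \<le> 1"
    using C1_nonneg[OF assms(1), of x] C1_le_1[OF assms(1), of x] assms(2,3) by auto
qed auto

section \<open>Additive functions on the unit interval\<close>

text \<open>Cauchy's functional equation: additivity settles the grid points \<open>j / N\<close>,
  nonnegativity gives monotonicity, and \<open>r\<close> is squeezed between neighbouring grid
  points.\<close>

lemma additive_nonneg_on_unit_interval_linear: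
  fixes s :: "real \<Rightarrow> real"
  assumes add: "\<And>r t. 0 \<le> r \<Longrightarrow> 0 \<le> t \<Longrightarrow> r + t \<le> 1 \<Longrightarrow> s (r + t) = s r + s t"
    and nonneg: "\<And>r. 0 \<le> r \<Longrightarrow> r \<le> 1 \<Longrightarrow> 0 \<le> s r"
    and r: "0 \<le> r" "r \<le> 1"
  shows "s r = r * s 1"
proof (cases "r = 1")
  case False
  have mono: "s u \<le> s v" if "0 \<le> u" "u \<le> v" "v \<le> 1" for u v
    using add[of u "v - u"] nonneg[of "v - u"] that by simp
  have mult: "s (real k * t) = real k * s t" if "0 \<le> t" "real k * t \<le> 1" for k t
    using that(2)
  proof (induction k)
    case 0
    show ?case using add[of 0 0] by simp
  next
    case (Suc k)
    then have "real k * t + t \<le> 1" by (simp add: algebra_simps)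
    then show ?case
      using Suc.IH add[of "real k * t" t] that(1) by (simp add: algebra_simps)
  qed
  have bound: "\<bar>s r - r * s 1\<bar> \<le> s 1 / real N" if "N > 0" for N :: nat
  proof -
    define k where "k = nat \<lfloor>r * real N\<rfloor>"
    have k: "real k \<le> r * real N" "r * real N < real k + 1"
      unfolding k_def using r(1) by (auto simp: le_floor_iff)
    \<comment> \<open>Since \<open>r < 1\<close> in this case, \<open>k + 1 \<le> N\<close>, so both
      neighbours \<open>k / N\<close> and \<open>(k + 1) / N\<close> of \<open>r\<close> lie in the
      unit interval.\<close>
    have rN: "r * real N < real N" using False r that by simp
    have kN: "k < N" using k(1) rN by linarith
    \<comment> \<open>Taking \<open>N\<close> copies of \<open>1 / N\<close> gives
      \<open>s (1 / N) = s 1 / N\<close>; taking \<open>j\<close> copies gives the rest.\<close>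
    have N: "s (real j / real N) = real j / real N * s 1" if "j \<le> N" for j
      using mult[of "1 / real N" j] mult[of "1 / real N" N] \<open>N > 0\<close> that by simp
    have lower: "real k / real N * s 1 \<le> s r"
      using mono[of "real k / real N" r] N[of k] k(1) r kN that by (simp add: field_simps)
    have "s r \<le> s (real (Suc k) / real N)"
      using k(2) r kN that by (intro mono) (simp_all add: field_simps)
    then have upper: "s r \<le> real (Suc k) / real N * s 1"
      using N[of "Suc k"] kN by simp
    have "real k / real N \<le> r" "r \<le> real (Suc k) / real N"
      using k that by (simp_all add: field_simps)
    then have "real k / real N * s 1 \<le> r * s 1" "r * s 1 \<le> real (Suc k) / real N * s 1"
      using nonneg[of 1] by (intro mult_right_mono; simp)+
    with lower upper show ?thesis by (simp add: add_divide_distrib distrib_right abs_le_iff)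
  qed
  have "\<bar>s r - r * s 1\<bar> \<le> 0"
  proof (rule LIMSEQ_le_const)
    show "(\<lambda>N. s 1 / real N) \<longlonglongrightarrow> 0" by (rule lim_const_over_n)
    show "\<exists>M. \<forall>N\<ge>M. \<bar>s r - r * s 1\<bar> \<le> s 1 / real N" using bound by (intro exI[of _ 1]) simp
  qed
  then show ?thesis by simp
qed simp

section \<open>States on \<open>C1 X\<close>\<close>

locale C1_state =
  fixes X :: "'a topology" and \<phi> :: "('a \<Rightarrow> real) \<Rightarrow> real"
  assumes nonneg: "f \<in> C1 X \<Longrightarrow> 0 \<le> \<phi> f"
    and unit: "\<phi> (C1_one X) = 1"
    and add: "f \<in> C1 X \<Longrightarrow> g \<in> C1 X \<Longrightarrow> C1_summable X f g \<Longrightarrow> \<phi> (C1_add X f g) = \<phi> f + \<phi> g"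
begin

text \<open>The difference \<open>g - f\<close> takes values in the unit interval, so it lies in
  \<open>C1 X\<close> and adds up with \<open>f\<close> to \<open>g\<close>.\<close>

lemma mono:
  assumes "f \<in> C1 X" "g \<in> C1 X" and "\<And>x. x \<in> topspace X \<Longrightarrow> f x \<le> g x"
  shows "\<phi> f \<le> \<phi> g"
proof -
  define h where "h = (\<lambda>x\<in>topspace X. g x - f x)"
  have h: "h \<in> C1 X"
    unfolding h_def
  proof (rule C1_restrictI)
    show "continuous_map X euclideanreal (\<lambda>x. g x - f x)"
      using assms(1,2) by (auto intro!: continuous_intros simp: C1_iff)
  next
    fix x assume "x \<in> topspace X"
    then show "g x - f x \<le> 1"
      using C1_nonneg[OF assms(1), of x] C1_le_1[OF assms(2), of x] by simp
  qed (use assms(3) in simp)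
  have "C1_add X f h = g"
    using C1_extensional[OF assms(2)]
    by (intro extensionalityI[of _ "topspace X"]) (auto simp: C1_add_def h_def)
  moreover have "C1_summable X f h"
    using C1_le_1[OF assms(2)] by (auto simp: C1_summable_def h_def)
  ultimately show ?thesis using add[OF assms(1) h] nonneg[OF h] by simp
qed

text \<open>For fixed \<open>f\<close>, the value of \<open>\<phi>\<close> at \<open>r * f\<close>
  is additive and nonnegative in \<open>r\<close> on the unit interval, hence linear.\<close>

lemma scale:
  assumes f: "f \<in> C1 X" and r: "0 \<le> r" "r \<le> 1"
  shows "\<phi> (\<lambda>x\<in>topspace X. r * f x) = r * \<phi> f"
proof -
  let ?s = "\<lambda>r. \<phi> (\<lambda>x\<in>topspace X. r * f x)"
  have "?s (u + v) = ?s u + ?s v" if uv: "0 \<le> u" "0 \<le> v" "u + v \<le> 1" for u v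
  proof -
    let ?u = "\<lambda>x\<in>topspace X. u * f x" and ?v = "\<lambda>x\<in>topspace X. v * f x"
    have "C1_summable X ?u ?v"
      using uv C1_nonneg[OF f] C1_le_1[OF f]
      by (auto simp: C1_summable_def mult_le_one simp flip: distrib_right)
    moreover have "C1_add X ?u ?v = (\<lambda>x\<in>topspace X. (u + v) * f x)"
      by (auto simp: C1_add_def distrib_right)
    ultimately show ?thesis
      using add[of ?u ?v] C1_scale[OF f, of u] C1_scale[OF f, of v] uv by simp
  qed
  moreover have "0 \<le> ?s u" if "0 \<le> u" "u \<le> 1" for u
    using f that by (intro nonneg C1_scale)
  ultimately have "?s r = r * ?s 1"
    using r by (rule additive_nonneg_on_unit_interval_linear)
  moreover have "(\<lambda>x\<in>topspace X. 1 * f x) = f"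
    using C1_extensional[OF f] by (simp add: extensional_restrict)
  ultimately show ?thesis by simp
qed

lemma const:
  assumes "0 \<le> c" "c \<le> 1"
  shows "\<phi> (\<lambda>x\<in>topspace X. c) = c"
proof -
  have "C1_one X \<in> C1 X" unfolding C1_one_def by (rule C1_const) simp_all
  then have "\<phi> (\<lambda>x\<in>topspace X. c * C1_one X x) = c"
    using scale assms unit by simp
  moreover have "(\<lambda>x\<in>topspace X. c * C1_one X x) = (\<lambda>x\<in>topspace X. c)"
    by (auto simp: C1_one_def)
  ultimately show ?thesis by simp
qed

text \<open>\<open>C\<^sub>1(X)\<close> is not closed under differences, so linear inequalities are stated with
  nonnegative coefficients on both sides.\<close>

lemma comb_mono:
  assumes C1: "f \<in> C1 X" "g \<in> C1 X" "h \<in> C1 X" "k \<in> C1 X"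
    and coeff: "0 \<le> p" "0 \<le> q" "0 \<le> r" "0 \<le> s"
    and le: "\<And>x. x \<in> topspace X \<Longrightarrow> p * f x + q * g x \<le> r * h x + s * k x"
  shows "p * \<phi> f + q * \<phi> g \<le> r * \<phi> h + s * \<phi> k"
proof -
  \<comment> \<open>Division by \<open>N\<close> brings both combinations into \<open>C1 X\<close>,
    as the coefficients on each side then sum to at most 1; the summand 1 keeps \<open>N\<close>
    positive.\<close>
  define N where "N = 1 + p + q + r + s"
  define comb where "comb a b u v =
    C1_add X (\<lambda>x\<in>topspace X. a / N * u x) (\<lambda>x\<in>topspace X. b / N * v x)"
    for a b and u v :: "'a \<Rightarrow> real"
  have N: "0 < N" using coeff by (simp add: N_def)
  have comb: "comb a b u v \<in> C1 X \<and> \<phi> (comb a b u v) = a / N * \<phi> u + b / N * \<phi> v"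
    if "0 \<le> a" "0 \<le> b" "a + b \<le> N" "u \<in> C1 X" "v \<in> C1 X" for a b u v
  proof -
    let ?u = "\<lambda>x\<in>topspace X. a / N * u x" and ?v = "\<lambda>x\<in>topspace X. b / N * v x"
    have ab: "0 \<le> a / N" "a / N \<le> 1" "0 \<le> b / N" "b / N \<le> 1" "a / N + b / N \<le> 1"
      using that N by (simp_all add: field_simps)
    have "C1_summable X ?u ?v"
      unfolding C1_summable_def
    proof
      fix x assume x: "x \<in> topspace X"
      have "a / N * u x \<le> a / N * 1" "b / N * v x \<le> b / N * 1"
        using x that ab by (intro mult_left_mono; simp add: C1_le_1)+
      then show "?u x + ?v x \<le> 1" using ab x by simp
    qed
    moreover have "?u \<in> C1 X" "?v \<in> C1 X" using ab that by (simp_all only: C1_scale)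
    ultimately show ?thesis
      unfolding comb_def
      using C1_add_closed add scale[OF \<open>u \<in> C1 X\<close> ab(1,2)] scale[OF \<open>v \<in> C1 X\<close> ab(3,4)] by metis
  qed
  have fg: "comb p q f g \<in> C1 X" "\<phi> (comb p q f g) = p / N * \<phi> f + q / N * \<phi> g"
    using comb[of p q f g] C1 coeff by (auto simp: N_def)
  have hk: "comb r s h k \<in> C1 X" "\<phi> (comb r s h k) = r / N * \<phi> h + s / N * \<phi> k"
    using comb[of r s h k] C1 coeff by (auto simp: N_def)
  have "comb p q f g x \<le> comb r s h k x" if "x \<in> topspace X" for x
    using divide_right_mono[OF le[OF that] less_imp_le[OF N]] that
    by (simp add: comb_def C1_add_def add_divide_distrib)
  then have "\<phi> (comb p q f g) \<le> \<phi> (comb r s h k)"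
    using mono fg(1) hk(1) by blast
  then have "(p * \<phi> f + q * \<phi> g) / N \<le> (r * \<phi> h + s * \<phi> k) / N"
    by (simp add: fg(2) hk(2) add_divide_distrib)
  then show ?thesis using N by (simp add: divide_le_cancel)
qed

text \<open>Each of \<open>f\<close> and \<open>g\<close> is at most the other plus
  \<open>L * e\<close>, and \<open>e\<close> contributes nothing under \<open>\<phi>\<close>. This
  is what allows functions to be frozen at their values at a point.\<close>

lemma lipschitz_eq:
  assumes "f \<in> C1 X" "g \<in> C1 X" "e \<in> C1 X" and "\<phi> e = 0" and "0 \<le> L"
    and "\<And>x. x \<in> topspace X \<Longrightarrow> \<bar>f x - g x\<bar> \<le> L * e x"
  shows "\<phi> f = \<phi> g"
proof (rule antisym)
  \<comment> \<open>The term with coefficient 0 pads the inequality to the shape of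
    \<open>comb_mono\<close>.\<close>
  have "1 * \<phi> f + 0 * \<phi> e \<le> 1 * \<phi> g + L * \<phi> e"
    using assms by (intro comb_mono) (auto simp: abs_le_iff algebra_simps)
  then show "\<phi> f \<le> \<phi> g" using assms(4) by simp
  have "1 * \<phi> g + 0 * \<phi> e \<le> 1 * \<phi> f + L * \<phi> e"
    using assms by (intro comb_mono) (auto simp: abs_le_iff algebra_simps)
  then show "\<phi> g \<le> \<phi> f" using assms(4) by simp
qed

section \<open>Vanishing mean deviation from a constant\<close>

lemma dist_const_eq_0_if_inf:
  assumes a: "a \<in> C1 X" and c: "0 \<le> c" "c \<le> 1"
    and "\<phi> a = c" and "\<phi> (C1_inf X a (\<lambda>x\<in>topspace X. c)) = c"
  shows "\<phi> (\<lambda>x\<in>topspace X. \<bar>a x - c\<bar>) = 0"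
proof -
  let ?e = "\<lambda>x\<in>topspace X. \<bar>a x - c\<bar>" and ?c = "\<lambda>x\<in>topspace X. c"
  let ?m = "C1_inf X a ?c"
  have e: "?e \<in> C1 X" using a c by (rule C1_dist_const)
  \<comment> \<open>Pointwise this is the equality \<open>|a - c| + 2 * min a c = a + c\<close>. As
    \<open>\<phi>\<close> takes the value \<open>c\<close> at \<open>a\<close>, \<open>?c\<close>
    and \<open>?m\<close>, it leaves \<open>\<phi> ?e \<le> 0\<close>.\<close>
  have "1 * \<phi> ?e + 2 * \<phi> ?m \<le> 1 * \<phi> a + 1 * \<phi> ?c"
    using e a C1_const[OF c] C1_inf_closed[OF a C1_const[OF c]]
    by (intro comb_mono) (auto simp: C1_inf_def)
  then show ?thesis using assms const[OF c] nonneg[OF e] by simp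
qed

text \<open>The hypotheses say that \<open>a\<close> has mean \<open>c\<close> and variance 0. The
  Cauchy-Schwarz argument is run in its parametric form
  \<open>2 * t * d \<le> t\<^sup>2 + d\<^sup>2\<close> with \<open>d = |a - c|\<close> and arbitrary
  \<open>t > 0\<close>, which is linear in the functions involved.\<close>

lemma dist_const_eq_0_if_square:
  assumes a: "a \<in> C1 X" and c: "0 \<le> c" "c \<le> 1"
    and "\<phi> a = c" and "\<phi> (C1_mult X a a) = c\<^sup>2"
  shows "\<phi> (\<lambda>x\<in>topspace X. \<bar>a x - c\<bar>) = 0"
proof -
  let ?e = "\<lambda>x\<in>topspace X. \<bar>a x - c\<bar>"
  have e: "?e \<in> C1 X" using a c by (rule C1_dist_const)
  have "\<phi> ?e \<le> t / 2" if t: "0 < t" for t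
  proof -
    \<comment> \<open>The square of \<open>t - |a x - c|\<close> expanded, with
      \<open>2 * c * a x\<close> moved to the left so that all coefficients are nonnegative.\<close>
    have AM_GM: "2 * t * \<bar>a x - c\<bar> + 2 * c * a x \<le> (t\<^sup>2 + c\<^sup>2) * 1 + 1 * (a x * a x)" for x
      using zero_le_power2[of "t - \<bar>a x - c\<bar>"]
      by (simp add: power2_eq_square algebra_simps)
    have "2 * t * \<phi> ?e + 2 * c * \<phi> a \<le> (t\<^sup>2 + c\<^sup>2) * \<phi> (C1_one X) + 1 * \<phi> (C1_mult X a a)"
      using e a c t C1_const[of 1 X] C1_mult_closed[OF a a] AM_GM
      by (intro comb_mono) (auto simp: C1_mult_def C1_one_def)
    \<comment> \<open>The mean and second moment of \<open>a\<close> contribute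
      \<open>2 * c\<^sup>2\<close> on either side, which cancels.\<close>
    then have "2 * t * \<phi> ?e \<le> t * t" using assms unit by (simp add: power2_eq_square)
    then show ?thesis using t by simp
  qed
  then have "\<phi> ?e \<le> 0 + t" if "0 < t" for t
    using that by force
  then have "\<phi> ?e \<le> 0" by (rule field_le_epsilon)
  then show ?thesis using nonneg[OF e] by simp
qed

end

section \<open>Operators as families of states, one for each point\<close>

lemma C1_state_eval:
  assumes "unital_additive X \<tau>" and "x \<in> topspace X"
  shows "C1_state X (\<lambda>f. \<tau> f x)"
proof
  show "0 \<le> \<tau> f x" if "f \<in> C1 X" for f
    using assms that C1_nonneg by (fastforce simp: unital_additive_def)
qed (use assms in \<open>auto simp: unital_additive_def C1_one_def C1_add_def\<close>)

lemma unital_additive_closed: "unital_additive X \<tau> \<Longrightarrow> f \<in> C1 X \<Longrightarrow> \<tau> f \<in> C1 X"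
  by (auto simp: unital_additive_def)

text \<open>Mean absolute deviation takes the place of variance because the Lipschitz bounds below
  are linear in it.\<close>

definition dispersion_free :: "'a topology \<Rightarrow> (('a \<Rightarrow> real) \<Rightarrow> 'a \<Rightarrow> real) \<Rightarrow> bool" where
  "dispersion_free X \<tau> \<longleftrightarrow>
     (\<forall>f\<in>C1 X. \<forall>x\<in>topspace X. \<tau> (\<lambda>y\<in>topspace X. \<bar>\<tau> f y - \<tau> f x\<bar>) x = 0)"

lemma strong_imp_dispersion_free:
  assumes "strong_state_operator X \<tau>"
  shows "dispersion_free X \<tau>"
  unfolding dispersion_free_def
proof (intro ballI)
  fix f x assume f: "f \<in> C1 X" and x: "x \<in> topspace X"
  have ua: "unital_additive X \<tau>" and idem: "\<tau> (\<tau> f) = \<tau> f"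
    using assms f by (auto simp: strong_state_operator_def state_operator_def)
  have tf: "\<tau> f \<in> C1 X" using ua f by (rule unital_additive_closed)
  have c: "0 \<le> \<tau> f x" "\<tau> f x \<le> 1" by (rule C1_nonneg[OF tf x] C1_le_1[OF tf x])+
  let ?c = "\<lambda>y\<in>topspace X. \<tau> f x"
  interpret C1_state X "\<lambda>f. \<tau> f x" using ua x by (rule C1_state_eval)
  \<comment> \<open>A constant is fixed by \<open>\<tau>\<close>, hence in its range, so strongness
    applies to its meet with \<open>\<tau> f\<close>.\<close>
  have "\<tau> ?c = ?c"
  proof (rule extensionalityI)
    show "\<tau> ?c \<in> extensional (topspace X)"
      using unital_additive_closed[OF ua C1_const[OF c]] by (rule C1_extensional)
    show "\<tau> ?c y = ?c y" if "y \<in> topspace X" for y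
      using C1_state.const[OF C1_state_eval[OF ua that] c] that by simp
  qed simp
  then have "\<tau> (C1_inf X (\<tau> f) ?c) = C1_inf X (\<tau> f) ?c"
    using assms f C1_const[OF c, of X] unfolding strong_state_operator_def by metis
  then show "\<tau> (\<lambda>y\<in>topspace X. \<bar>\<tau> f y - \<tau> f x\<bar>) x = 0"
    using dist_const_eq_0_if_inf[OF tf c] idem x by (simp add: C1_inf_def)
qed

lemma conditional_expectation_imp_dispersion_free:
  assumes "state_operator X \<tau>" and ce: "conditional_expectation X \<tau>"
  shows "dispersion_free X \<tau>"
  unfolding dispersion_free_def
proof (intro ballI)
  fix f x assume f: "f \<in> C1 X" and x: "x \<in> topspace X"
  have ua: "unital_additive X \<tau>" and idem: "\<tau> (\<tau> f) = \<tau> f"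
    using assms f by (auto simp: state_operator_def)
  have tf: "\<tau> f \<in> C1 X" using ua f by (rule unital_additive_closed)
  have c: "0 \<le> \<tau> f x" "\<tau> f x \<le> 1" by (rule C1_nonneg[OF tf x] C1_le_1[OF tf x])+
  interpret C1_state X "\<lambda>f. \<tau> f x" using ua x by (rule C1_state_eval)
  have one: "C1_one X \<in> C1 X" "\<tau> (C1_one X) = C1_one X"
    using ua C1_const[of 1 X] by (auto simp: C1_one_def unital_additive_def)
  \<comment> \<open>Taking \<open>g\<close> to be the unit in the defining identity makes the square
    of \<open>\<tau> f\<close> a fixed point.\<close>
  have sq: "C1_mult X (C1_mult X (\<tau> f) (C1_one X)) (\<tau> f) = C1_mult X (\<tau> f) (\<tau> f)"
    by (auto simp: C1_mult_def C1_one_def)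
  have "\<tau> (C1_mult X (\<tau> f) (\<tau> f)) = C1_mult X (\<tau> f) (\<tau> f)"
    using ce f one sq unfolding conditional_expectation_def by metis
  then show "\<tau> (\<lambda>y\<in>topspace X. \<bar>\<tau> f y - \<tau> f x\<bar>) x = 0"
    using dist_const_eq_0_if_square[OF tf c] idem x by (simp add: C1_mult_def power2_eq_square)
qed

lemma dispersion_free_imp_conditional_expectation:
  assumes ua: "unital_additive X \<tau>" and df: "dispersion_free X \<tau>"
  shows "conditional_expectation X \<tau>"
  unfolding conditional_expectation_def
proof (intro conjI ballI)
  fix f g assume f: "f \<in> C1 X" and g: "g \<in> C1 X"
  have tf: "\<tau> f \<in> C1 X" using ua f by (rule unital_additive_closed)
  let ?l = "C1_mult X (C1_mult X (\<tau> f) g) (\<tau> f)"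
  have l: "?l \<in> C1 X" using tf g by (intro C1_mult_closed)
  show "\<tau> ?l = C1_mult X (C1_mult X (\<tau> f) (\<tau> g)) (\<tau> f)"
  proof (rule extensionalityI)
    show "\<tau> ?l \<in> extensional (topspace X)"
      using unital_additive_closed[OF ua l] by (rule C1_extensional)
    fix x assume x: "x \<in> topspace X"
    interpret C1_state X "\<lambda>f. \<tau> f x" using ua x by (rule C1_state_eval)
    define c where "c = \<tau> f x"
    \<comment> \<open>\<open>?r\<close> is \<open>?l\<close> with \<open>\<tau> f\<close> frozen at
      its value at \<open>x\<close>; by homogeneity its image at \<open>x\<close> is
      \<open>c\<^sup>2 * \<tau> g x\<close>, the required value.\<close>
    let ?r = "\<lambda>y\<in>topspace X. c\<^sup>2 * g y"
    have c: "0 \<le> c" "c \<le> 1" unfolding c_def by (rule C1_nonneg[OF tf x] C1_le_1[OF tf x])+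
    have c2: "0 \<le> c\<^sup>2" "c\<^sup>2 \<le> 1" using c by (simp_all add: power_le_one)
    have "\<tau> ?l x = \<tau> ?r x"
    proof (rule lipschitz_eq)
      show "?r \<in> C1 X" using g c2 by (rule C1_scale)
      show "(\<lambda>y\<in>topspace X. \<bar>\<tau> f y - c\<bar>) \<in> C1 X" using tf c by (rule C1_dist_const)
      show "\<tau> (\<lambda>y\<in>topspace X. \<bar>\<tau> f y - c\<bar>) x = 0"
        using df f x by (simp add: dispersion_free_def c_def)
      fix y assume y: "y \<in> topspace X"
      have bounds: "0 \<le> \<tau> f y" "\<tau> f y \<le> 1" "0 \<le> g y" "g y \<le> 1"
        using y tf g by (simp_all add: C1_nonneg C1_le_1)
      \<comment> \<open>Difference of squares; the Lipschitz constant 2 comes from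
        \<open>\<tau> f y + c \<le> 2\<close> and \<open>g y \<le> 1\<close>.\<close>
      have "?l y - ?r y = (\<tau> f y + c) * g y * (\<tau> f y - c)"
        using y by (simp add: C1_mult_def power2_eq_square algebra_simps)
      then have "\<bar>?l y - ?r y\<bar> = (\<tau> f y + c) * g y * \<bar>\<tau> f y - c\<bar>"
        using bounds c by (simp add: abs_mult)
      also have "\<dots> \<le> 2 * 1 * \<bar>\<tau> f y - c\<bar>"
        using bounds c by (intro mult_right_mono mult_mono) auto
      finally show "\<bar>?l y - ?r y\<bar> \<le> 2 * (\<lambda>y\<in>topspace X. \<bar>\<tau> f y - c\<bar>) y" using y by simp
    qed (use l in auto)
    then show "\<tau> ?l x = C1_mult X (C1_mult X (\<tau> f) (\<tau> g)) (\<tau> f) x"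
      using scale[OF g c2] x by (simp add: C1_mult_def c_def power2_eq_square)
  qed (simp add: C1_mult_def)
qed (rule ua)

lemma dispersion_free_imp_strong:
  assumes so: "state_operator X \<tau>" and df: "dispersion_free X \<tau>"
  shows "strong_state_operator X \<tau>"
  unfolding strong_state_operator_def
proof (intro conjI ballI)
  have ua: "unital_additive X \<tau>" using so by (simp add: state_operator_def)
  fix f g assume f: "f \<in> C1 X" and g: "g \<in> C1 X"
  have tf: "\<tau> f \<in> C1 X" and tg: "\<tau> g \<in> C1 X" using ua f g by (auto intro: unital_additive_closed)
  let ?m = "C1_inf X (\<tau> f) (\<tau> g)"
  have m: "?m \<in> C1 X" using tf tg by (rule C1_inf_closed)
  show "\<tau> ?m = ?m"
  proof (rule extensionalityI)
    show "\<tau> ?m \<in> extensional (topspace X)"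
      using unital_additive_closed[OF ua m] by (rule C1_extensional)
    fix x assume x: "x \<in> topspace X"
    interpret C1_state X "\<lambda>f. \<tau> f x" using ua x by (rule C1_state_eval)
    define c where "c = \<tau> f x"
    define d where "d = \<tau> g x"
    let ?k = "\<lambda>y\<in>topspace X. min c d"
    let ?ef = "\<lambda>y\<in>topspace X. \<bar>\<tau> f y - c\<bar>" and ?eg = "\<lambda>y\<in>topspace X. \<bar>\<tau> g y - d\<bar>"
    let ?e = "\<lambda>y\<in>topspace X. \<bar>?m y - min c d\<bar>"
    have cd: "0 \<le> c" "c \<le> 1" "0 \<le> d" "d \<le> 1"
      using tf tg x by (simp_all add: C1_nonneg C1_le_1 c_def d_def)
    have e: "?e \<in> C1 X" using m cd by (intro C1_dist_const) auto
    \<comment> \<open>Rests on \<open>|min a b - min c d| \<le> |a - c| + |b - d|\<close>; both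
      deviations on the right have image 0 at \<open>x\<close>.\<close>
    have "1 * \<tau> ?e x + 0 * \<tau> ?e x \<le> 1 * \<tau> ?ef x + 1 * \<tau> ?eg x"
      using e C1_dist_const[OF tf cd(1,2)] C1_dist_const[OF tg cd(3,4)]
      by (intro comb_mono) (auto simp: C1_inf_def)
    also have "\<dots> = 0" using df f g x by (simp add: dispersion_free_def c_def d_def)
    finally have "\<tau> ?e x = 0" using nonneg[OF e] by simp
    \<comment> \<open>\<open>?m\<close> differs from the constant \<open>?k\<close> by exactly
      \<open>?e\<close>, whence the Lipschitz constant 1.\<close>
    then have "\<tau> ?m x = \<tau> ?k x"
      using m e cd C1_const[of "min c d" X] by (intro lipschitz_eq[of _ _ ?e 1]) auto
    then show "\<tau> ?m x = ?m x"
      using const[of "min c d"] cd x by (simp add: C1_inf_def c_def d_def)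
  qed (simp add: C1_inf_def)
qed (rule so)

theorem theorem6p1:
  fixes X :: "'a topology" and \<tau> :: "('a \<Rightarrow> real) \<Rightarrow> 'a \<Rightarrow> real"
  assumes "compact_space X" and "Hausdorff_space X"
    and "state_operator X \<tau>"
  shows "conditional_expectation X \<tau> \<longleftrightarrow> strong_state_operator X \<tau>"
proof
  assume "conditional_expectation X \<tau>"
  with assms(3) show "strong_state_operator X \<tau>"
    by (intro dispersion_free_imp_strong conditional_expectation_imp_dispersion_free)
next
  assume "strong_state_operator X \<tau>"
  moreover have "unital_additive X \<tau>" using assms(3) by (simp add: state_operator_def)
  ultimately show "conditional_expectation X \<tau>"
    by (intro dispersion_free_imp_conditional_expectation strong_imp_dispersion_free)
qed

end
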